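(* Let $\mathcal{B}=B(F)\subseteq 2^{[n]}$ be a principal Borel set with Borel generator $F=\{i_1<i_2<\cdots<i_d\}$, and let $\Delta$ be the simplicial complex on $[n]$ with $\mathcal{F}(\Delta)=\mathcal{B}$. Then $B(\Delta^{(j)})=A(\Delta^{(j)})$ for every $j=0,\ldots,d-1$.
   Context: Let $K$ be a field, $[n]=\{1,\ldots,n\}$ and $S=K[x_1,\ldots,x_n]$. A subset $\mathcal{B}\subseteq 2^{[n]}$ is Borel if whenever $F\in\mathcal{B}$, $i<j$, $i\in[n]\setminus F$ and $j\in F$, then $(F\setminus\{j\})\cup\{i\}\in\mathcal{B}$. $B(F)$ denotes the smallest Borel subset of $2^{[n]}$ containing $F$; such Borel sets are called principal, with Borel generator $F$. $\mathcal{F}(\Delta)$ is the set of facets (maximal faces) of $\Delta$. The $j$-skeleton $\Delta^{(j)}$ is the simplicial complex of all faces $G\in\Delta$ with $\dim G=|G|-1\le j$. For a simplicial complex $\Gamma$ on $[n]$ and $k\ge 0$, a $k$-cover of $\Gamma$ is a nonzero vector $c\in\mathbb{Z}_{\ge 0}^n$ with $\sum_{i\in G}c_i\ge k$ for every facet $G$ of $\Gamma$; it is squarefree if all $c_i\le 1$. Write $x^c=x_1^{c_1}\cdots x_n^{c_n}$. For $k\ge 1$, $J_k(\Gamma)\subseteq S$ is the ideal spanned over $K$ by the monomials $x^c$ with $c$ a $k$-cover, $J_0(\Gamma)=S$, and $A(\Gamma)=\bigoplus_{k\ge 0}J_k(\Gamma)t^k\subseteq S[t]$. $B(\Gamma)\subseteq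 S[t]$ (for a simplicial complex $\Gamma$) is the $S$-subalgebra generated by all $x^ct^k$ with $k\ge 1$ and $c$ a squarefree $k$-cover of $\Gamma$. *)

theory Defs
  imports "HOL-Library.Poly_Mapping" "HOL-Computational_Algebra.Polynomial"
begin

definition borel_set :: "nat \<Rightarrow> nat set set \<Rightarrow> bool" where
  "borel_set n \<B> \<longleftrightarrow> \<B> \<subseteq> Pow {1..n} \<and>
     (\<forall>F\<in>\<B>. \<forall>i j. i < j \<longrightarrow> i \<in> {1..n} - F \<longrightarrow> j \<in> F \<longrightarrow> insert i (F - {j}) \<in> \<B>)"

text \<open>The intersection is itself a Borel set containing \<open>F\<close> when \<open>F \<subseteq> {1..n}\<close>, since
  \<open>Pow {1..n}\<close> is Borel and Borel sets are closed under intersection.\<close>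

definition principal_borel :: "nat \<Rightarrow> nat set \<Rightarrow> nat set set" where
  "principal_borel n F = \<Inter>{\<B>. borel_set n \<B> \<and> F \<in> \<B>}"

text \<open>Not every singleton \<open>{i}\<close> with \<open>i \<in> {1..n}\<close> is required to be a face.\<close>

definition simplicial_complex :: "nat \<Rightarrow> nat set set \<Rightarrow> bool" where
  "simplicial_complex n \<Delta> \<longleftrightarrow> \<Delta> \<subseteq> Pow {1..n} \<and> (\<forall>G\<in>\<Delta>. \<forall>H. H \<subseteq> G \<longrightarrow> H \<in> \<Delta>)"

definition facets :: "nat set set \<Rightarrow> nat set set" where
  "facets \<Delta> = {G \<in> \<Delta>. \<forall>H\<in>\<Delta>. G \<subseteq> H \<longrightarrow> H = G}"

definition face_dim :: "nat set \<Rightarrow> int" where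
  "face_dim G = int (card G) - 1"

definition skeleton :: "nat set set \<Rightarrow> nat \<Rightarrow> nat set set" where
  "skeleton \<Delta> j = {G \<in> \<Delta>. face_dim G \<le> int j}"

text \<open>A vector \<open>c \<in> \<nat>\<^sup>n\<close> is a finitely supported function with support in \<open>{1..n}\<close>; it doubles as
  the exponent of the monomial \<open>x\<^sup>c\<close>.\<close>

definition k_cover :: "nat \<Rightarrow> nat set set \<Rightarrow> nat \<Rightarrow> (nat \<Rightarrow>\<^sub>0 nat) \<Rightarrow> bool" where
  "k_cover n \<Gamma> k c \<longleftrightarrow> Poly_Mapping.keys c \<subseteq> {1..n} \<and> c \<noteq> 0 \<and>
     (\<forall>G\<in>facets \<Gamma>. (\<Sum>i\<in>G. Poly_Mapping.lookup c i) \<ge> k)"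

definition squarefree_cover :: "nat \<Rightarrow> nat set set \<Rightarrow> nat \<Rightarrow> (nat \<Rightarrow>\<^sub>0 nat) \<Rightarrow> bool" where
  "squarefree_cover n \<Gamma> k c \<longleftrightarrow> k_cover n \<Gamma> k c \<and> (\<forall>i. Poly_Mapping.lookup c i \<le> 1)"

text \<open>\<open>'k mpoly\<close> is the polynomial ring over \<open>'k\<close> in countably many variables;
  \<open>S = K[x\<^sub>1, \<dots>, x\<^sub>n]\<close> is its subring \<open>poly_ring n\<close>. Elements of \<open>S[t]\<close> are
  univariate polynomials over \<open>'k mpoly\<close> with coefficients in \<open>poly_ring n\<close>.\<close>

type_synonym 'k mpoly = "(nat \<Rightarrow>\<^sub>0 nat) \<Rightarrow>\<^sub>0 'k"

definition poly_ring :: "nat \<Rightarrow> 'k::field mpoly set" where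
  "poly_ring n = {p. \<forall>c\<in>Poly_Mapping.keys p. Poly_Mapping.keys c \<subseteq> {1..n}}"

definition xpow :: "(nat \<Rightarrow>\<^sub>0 nat) \<Rightarrow> 'k::field mpoly" where
  "xpow c = Poly_Mapping.single c 1"

definition scale :: "'k::field \<Rightarrow> 'k mpoly \<Rightarrow> 'k mpoly" where
  "scale a p = Poly_Mapping.single 0 a * p"

interpretation mpoly: vector_space scale
  by unfold_locales
    (simp_all add: scale_def distrib_left distrib_right single_add mult_single
      flip: mult.assoc)

text \<open>For \<open>k \<ge> 1\<close> the linear span is already an ideal of \<open>S\<close>, since the set of \<open>k\<close>-covers is closed
  under adding vectors of \<open>\<nat>\<^sup>n\<close>.\<close>

definition cover_ideal :: "nat \<Rightarrow> nat set set \<Rightarrow> nat \<Rightarrow> 'k::field mpoly set" where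
  "cover_ideal n \<Gamma> k =
     (if k = 0 then poly_ring n else mpoly.span {xpow c | c. k_cover n \<Gamma> k c})"

definition cover_algebra :: "nat \<Rightarrow> nat set set \<Rightarrow> 'k::field mpoly poly set" where
  "cover_algebra n \<Gamma> = {p. \<forall>k. coeff p k \<in> cover_ideal n \<Gamma> k}"

text \<open>The \<open>S\<close>-subalgebra of \<open>S[t]\<close> generated by a set is the smallest subset containing
  \<open>S\<close> and the generators and closed under sums and products.\<close>

inductive_set squarefree_cover_algebra :: "nat \<Rightarrow> nat set set \<Rightarrow> 'k::field mpoly poly set"
  for n :: nat and \<Gamma> :: "nat set set" where
  const: "s \<in> poly_ring n \<Longrightarrow> [:s:] \<in> squarefree_cover_algebra n \<Gamma>"
| gen: "k \<ge> 1 \<Longrightarrow> squarefree_cover n \<Gamma> k c \<Longrightarrow>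
    monom (xpow c) k \<in> squarefree_cover_algebra n \<Gamma>"
| add: "p \<in> squarefree_cover_algebra n \<Gamma> \<Longrightarrow> q \<in> squarefree_cover_algebra n \<Gamma> \<Longrightarrow>
    p + q \<in> squarefree_cover_algebra n \<Gamma>"
| mult: "p \<in> squarefree_cover_algebra n \<Gamma> \<Longrightarrow> q \<in> squarefree_cover_algebra n \<Gamma> \<Longrightarrow>
    p * q \<in> squarefree_cover_algebra n \<Gamma>"

end

theory Submission
  imports Defs
begin

text \<open>
  The complex \<open>\<Delta>\<close> is the independence complex of a matroid, and the equality of the two algebras
  holds for every matroid complex, in particular for the skeletons of \<open>\<Delta>\<close>, which are truncations
  of that matroid.

  For the matroid property, let \<open>f q\<close> be the number of elements of the generator \<open>F\<close> above \<open>q\<close>.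
  The members of \<open>B(F)\<close> are exactly the sets \<open>G \<subseteq> {1..n}\<close> with \<open>card G = card F\<close> that have at
  most \<open>f q\<close> elements above \<open>q\<close>, for each \<open>q\<close> (\<open>principal_borel_eq\<close>). Dropping the cardinality
  condition describes the faces of \<open>\<Delta>\<close> (\<open>principal_borel_complex_eq\<close>). Such capacity constraints on a
  chain of sets define a matroid: a smaller face can be augmented from a larger one below the
  least \<open>q\<close> whose constraint is attained (\<open>borel_dominated_augment\<close>).

  For the equality of the algebras on a matroid complex \<open>\<Gamma>\<close>, write a \<open>k\<close>-cover \<open>c\<close> as the sum of
  the indicator vectors of its level sets \<open>{i. t \<le> c\<^sub>i}\<close>, \<open>t \<ge> 1\<close>. The greedy
  algorithm uses only the order of the weights, and it produces one facet \<open>G\<close> that meets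
  each level set in the least possible number \<open>r\<^sub>t\<close> of elements, simultaneously for all \<open>t\<close>
  (\<open>exists_facet_minimizing_all_levels\<close>). Hence the \<open>t\<close>-th indicator is a squarefree
  \<open>r\<^sub>t\<close>-cover whenever \<open>r\<^sub>t > 0\<close>, and the sum of the \<open>r\<^sub>t\<close> is the \<open>c\<close>-weight of \<open>G\<close>, which is at least \<open>k\<close>. So \<open>x\<^sup>c t\<^sup>k\<close> is a
  product of generators of the squarefree cover algebra and of monomials of \<open>S\<close>
  (\<open>monom_cover_mem\<close>).
\<close>

section \<open>Matroid complexes\<close>

definition matroid_complex :: "nat \<Rightarrow> nat set set \<Rightarrow> bool" where
  "matroid_complex n \<Gamma> \<longleftrightarrow> simplicial_complex n \<Gamma> \<and> {} \<in> \<Gamma> \<and>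
     (\<forall>H\<in>\<Gamma>. \<forall>H'\<in>\<Gamma>. card H < card H' \<longrightarrow> (\<exists>x\<in>H' - H. insert x H \<in> \<Gamma>))"

lemma matroid_complexD:
  assumes "matroid_complex n \<Gamma>"
  shows matroid_subset: "H \<in> \<Gamma> \<Longrightarrow> H \<subseteq> {1..n}"
    and matroid_finite: "H \<in> \<Gamma> \<Longrightarrow> finite H"
    and matroid_down: "H \<in> \<Gamma> \<Longrightarrow> H' \<subseteq> H \<Longrightarrow> H' \<in> \<Gamma>"
    and matroid_empty: "{} \<in> \<Gamma>"
    and matroid_augment: "H \<in> \<Gamma> \<Longrightarrow> H' \<in> \<Gamma> \<Longrightarrow> card H < card H' \<Longrightarrow> \<exists>x\<in>H' - H. insert x H \<in> \<Gamma>"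
  using assms finite_subset[of H "{1..n}"]
  unfolding matroid_complex_def simplicial_complex_def by blast+

lemma matroid_complex_skeleton:
  assumes "matroid_complex n \<Gamma>"
  shows "matroid_complex n (skeleton \<Gamma> j)"
proof -
  have mem: "H \<in> skeleton \<Gamma> j \<longleftrightarrow> H \<in> \<Gamma> \<and> card H \<le> Suc j" for H
    by (auto simp: skeleton_def face_dim_def)
  have aug: "\<exists>x\<in>H' - H. insert x H \<in> skeleton \<Gamma> j"
    if "H \<in> skeleton \<Gamma> j" "H' \<in> skeleton \<Gamma> j" "card H < card H'" for H H'
  proof -
    have H: "H \<in> \<Gamma>" and H': "H' \<in> \<Gamma>" "card H' \<le> Suc j" "card H < card H'"
      using that by (simp_all add: mem)
    obtain x where x: "x \<in> H' - H" "insert x H \<in> \<Gamma>"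
      using matroid_augment[OF assms H H'(1,3)] by (elim bexE)
    have "card (insert x H) \<le> Suc (card H)"
      using matroid_finite[OF assms H] by (simp add: card_insert_if)
    then have "insert x H \<in> skeleton \<Gamma> j" using x(2) H'(2,3) by (simp add: mem)
    with x(1) show ?thesis by (rule bexI[rotated])
  qed
  have down: "H' \<in> skeleton \<Gamma> j" if "H \<in> skeleton \<Gamma> j" "H' \<subseteq> H" for H H'
  proof -
    have H: "H \<in> \<Gamma>" "card H \<le> Suc j" using that(1) by (simp_all add: mem)
    then show ?thesis
      using matroid_down[OF assms H(1) that(2)] card_mono[OF matroid_finite[OF assms H(1)] that(2)]
      by (simp add: mem)
  qed
  have "skeleton \<Gamma> j \<subseteq> Pow {1..n}" using matroid_subset[OF assms] mem by blast
  moreover have "{} \<in> skeleton \<Gamma> j" using matroid_empty[OF assms] by (simp add: mem)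
  ultimately show ?thesis
    unfolding matroid_complex_def simplicial_complex_def using aug down by blast
qed

lemma card_le_card_facet:
  assumes "matroid_complex n \<Gamma>" "G \<in> facets \<Gamma>" "H \<in> \<Gamma>"
  shows "card H \<le> card G"
proof (rule ccontr)
  assume "\<not> card H \<le> card G"
  then obtain x where "x \<in> H - G" "insert x G \<in> \<Gamma>"
    using matroid_augment[OF assms(1), of G H] assms(2,3) by (auto simp: facets_def)
  then show False using assms(2) by (auto simp: facets_def)
qed

lemma facet_if_card_max:
  assumes "matroid_complex n \<Gamma>" "G \<in> \<Gamma>" "\<And>H. H \<in> \<Gamma> \<Longrightarrow> card H \<le> card G"
  shows "G \<in> facets \<Gamma>"
  using assms card_seteq[of _ G] matroid_finite[OF assms(1)]
  unfolding facets_def by blast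

text \<open>
  By augmentation, a face that is maximal inside \<open>A\<close> has the largest cardinality among all faces
  inside \<open>A\<close>. Starting from \<open>H0\<close> gives one step of the greedy algorithm, which discards no earlier
  choice.
\<close>

lemma exists_maximal_extension:
  assumes M: "matroid_complex n \<Gamma>" and "H0 \<in> \<Gamma>" "H0 \<subseteq> A"
  shows "\<exists>H\<in>\<Gamma>. H0 \<subseteq> H \<and> H \<subseteq> A \<and> (\<forall>H'\<in>\<Gamma>. card (H' \<inter> A) \<le> card H)"
proof -
  let ?P = "\<lambda>H. H \<in> \<Gamma> \<and> H0 \<subseteq> H \<and> H \<subseteq> A"
  have "card H \<le> n" if "?P H" for H
    using card_mono[of "{1..n}" H] matroid_subset[OF M, of H] that by auto
  then obtain H where H: "?P H" and max: "\<And>H'. ?P H' \<Longrightarrow> card H' \<le> card H"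
    using ex_has_greatest_nat[of ?P H0 card "Suc n"] assms(2,3) by (auto simp: less_Suc_eq_le)
  have "card (H' \<inter> A) \<le> card H" if "H' \<in> \<Gamma>" for H'
  proof (rule ccontr)
    assume "\<not> ?thesis"
    moreover have "H' \<inter> A \<in> \<Gamma>" using matroid_down[OF M that] by blast
    ultimately obtain x where x: "x \<in> H' \<inter> A - H" "insert x H \<in> \<Gamma>"
      using matroid_augment[OF M, of H "H' \<inter> A"] H by auto
    then have "card (insert x H) \<le> card H" using H by (intro max) auto
    then show False using x matroid_finite[OF M, of H] H by simp
  qed
  then show ?thesis using H by blast
qed

text \<open>
  The greedy algorithm, processing the elements in the order of their weights. Since the face only
  grows, and grows only by elements of the current weight, its part below each earlier threshold
  stays as large as possible.
\<close>

lemma exists_greedy_face: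
  fixes w :: "nat \<Rightarrow> nat"
  assumes M: "matroid_complex n \<Gamma>"
  shows "\<exists>H\<in>\<Gamma>. H \<subseteq> {i. w i < m} \<and>
    (\<forall>t\<le>m. \<forall>H'\<in>\<Gamma>. card (H' \<inter> {i. w i < t}) \<le> card (H \<inter> {i. w i < t}))"
proof (induction m)
  case 0
  then show ?case using matroid_empty[OF M] by auto
next
  case (Suc m)
  then obtain H0 where H0: "H0 \<in> \<Gamma>" "H0 \<subseteq> {i. w i < m}"
    "\<And>t H'. t \<le> m \<Longrightarrow> H' \<in> \<Gamma> \<Longrightarrow> card (H' \<inter> {i. w i < t}) \<le> card (H0 \<inter> {i. w i < t})" by blast
  from H0(2) have "H0 \<subseteq> {i. w i < Suc m}" by auto
  from exists_maximal_extension[OF M H0(1) this] obtain H where H: "H \<in> \<Gamma>" "H0 \<subseteq> H"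
    "H \<subseteq> {i. w i < Suc m}" "\<forall>H'\<in>\<Gamma>. card (H' \<inter> {i. w i < Suc m}) \<le> card H"
    by (elim bexE conjE) (rule that)
  have "card (H' \<inter> {i. w i < t}) \<le> card (H \<inter> {i. w i < t})"
    if "t \<le> Suc m" "H' \<in> \<Gamma>" for t H'
  proof (cases "t = Suc m")
    case True
    with H(3) have "H \<inter> {i. w i < t} = H" by auto
    then show ?thesis using bspec[OF H(4) that(2)] True by simp
  next
    case False
    then have "card (H' \<inter> {i. w i < t}) \<le> card (H0 \<inter> {i. w i < t})"
      using H0(3) that by simp
    also have "\<dots> \<le> card (H \<inter> {i. w i < t})"
      using H(2) matroid_finite[OF M H(1)] by (intro card_mono) auto
    finally show ?thesis .
  qed
  then show ?case using H(1,3) by blast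
qed

text \<open>
  All facets have the same cardinality, so a facet that has as many elements as possible of weight
  below \<open>t\<close> has as few as possible of weight at least \<open>t\<close>.
\<close>

lemma exists_facet_minimizing_all_levels:
  fixes w :: "nat \<Rightarrow> nat"
  assumes M: "matroid_complex n \<Gamma>" and bound: "\<And>i. w i \<le> m"
  shows "\<exists>G\<in>facets \<Gamma>. \<forall>t\<le>m. \<forall>G'\<in>facets \<Gamma>.
    card (G \<inter> {i. t \<le> w i}) \<le> card (G' \<inter> {i. t \<le> w i})"
proof -
  obtain G where G: "G \<in> \<Gamma>" and max: "\<And>t H. t \<le> Suc m \<Longrightarrow> H \<in> \<Gamma> \<Longrightarrow>
      card (H \<inter> {i. w i < t}) \<le> card (G \<inter> {i. w i < t})"
    using exists_greedy_face[OF M, of w "Suc m"] by blast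
  have all: "{i. w i < Suc m} = UNIV" using bound by (auto simp: less_Suc_eq_le)
  have facet: "G \<in> facets \<Gamma>"
    using facet_if_card_max[OF M G] max[of "Suc m"] all by simp
  have split: "card (H \<inter> {i. t \<le> w i}) + card (H \<inter> {i. w i < t}) = card H"
    if "H \<in> \<Gamma>" for H t
  proof -
    have "card (H \<inter> {i. t \<le> w i} \<union> H \<inter> {i. w i < t})
        = card (H \<inter> {i. t \<le> w i}) + card (H \<inter> {i. w i < t})"
      using matroid_finite[OF M that] by (intro card_Un_disjoint) auto
    moreover have "H \<inter> {i. t \<le> w i} \<union> H \<inter> {i. w i < t} = H" by auto
    ultimately show ?thesis by simp
  qed
  have "card (G \<inter> {i. t \<le> w i}) \<le> card (G' \<inter> {i. t \<le> w i})"
    if "t \<le> m" "G' \<in> facets \<Gamma>" for t G'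
  proof -
    have G': "G' \<in> \<Gamma>" using that by (simp add: facets_def)
    show ?thesis
      using split[OF G, of t] split[OF G', of t] max[of t G'] G' that(1)
        card_le_card_facet[OF M that(2) G] by linarith
  qed
  with facet show ?thesis by blast
qed

section \<open>Principal Borel sets\<close>

text \<open>
  For finite sets of positive numbers of equal size this is the componentwise order of the
  increasingly sorted elements. The counting form also compares sets of different sizes, aligned
  at their largest elements.
\<close>

definition borel_dominated :: "nat set \<Rightarrow> nat set \<Rightarrow> bool" where
  "borel_dominated F H \<longleftrightarrow> (\<forall>q. card (H \<inter> {q<..}) \<le> card (F \<inter> {q<..}))"

text \<open>
  Inserting \<open>x\<close> can only violate the constraints at thresholds below \<open>x\<close>, so it is harmless when no
  constraint below \<open>x\<close> is attained by \<open>H\<close>. Let \<open>q\<close> be the least attained threshold. Above \<open>q\<close> the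
  set \<open>H'\<close> has no more elements than \<open>H\<close>; hence it has more elements than \<open>H\<close> up to \<open>q\<close>, and any
  element of \<open>H' - H\<close> up to \<open>q\<close> can be inserted.
\<close>

lemma borel_dominated_augment:
  assumes fin: "finite H" "finite H'" and dom: "borel_dominated F H" "borel_dominated F H'"
    and less: "card H < card H'"
  shows "\<exists>x\<in>H' - H. borel_dominated F (insert x H)"
proof -
  let ?tight = "\<lambda>q. card (H \<inter> {q<..}) = card (F \<inter> {q<..})"
  have ext: "borel_dominated F (insert x H)" if x: "\<And>q. q < x \<Longrightarrow> \<not> ?tight q" for x
    unfolding borel_dominated_def
  proof
    fix q
    have le: "card (H \<inter> {q<..}) \<le> card (F \<inter> {q<..})"
      using dom by (simp add: borel_dominated_def)
    show "card (insert x H \<inter> {q<..}) \<le> card (F \<inter> {q<..})"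
    proof (cases "q < x")
      case True
      then have "insert x H \<inter> {q<..} = insert x (H \<inter> {q<..})" by auto
      then have "card (insert x H \<inter> {q<..}) \<le> Suc (card (H \<inter> {q<..}))"
        using card_insert_le_m1 fin by (simp add: card_insert_if)
      then show ?thesis using le x[OF True] by linarith
    next
      case False
      then have "insert x H \<inter> {q<..} = H \<inter> {q<..}" by auto
      then show ?thesis using le by simp
    qed
  qed
  show ?thesis
  proof (cases "\<exists>q. ?tight q")
    case False
    have "\<not> H' \<subseteq> H" using less card_mono[OF fin(1)] by (meson not_le)
    then show ?thesis using ext False by blast
  next
    case True
    define q where "q = (LEAST q. ?tight q)"
    have tight: "?tight q" using True unfolding q_def by (rule LeastI_ex)
    have split: "card X = card (X \<inter> {..q}) + card (X \<inter> {q<..})" if "finite X" for X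
    proof -
      have "X \<inter> {..q} \<union> X \<inter> {q<..} = X" by auto
      moreover have "card (X \<inter> {..q} \<union> X \<inter> {q<..}) = card (X \<inter> {..q}) + card (X \<inter> {q<..})"
        using that by (intro card_Un_disjoint) auto
      ultimately show ?thesis by simp
    qed
    have "card (H' \<inter> {q<..}) \<le> card (H \<inter> {q<..})"
      using dom(2) tight by (simp add: borel_dominated_def)
    then have "card (H \<inter> {..q}) < card (H' \<inter> {..q})"
      using split[OF fin(1)] split[OF fin(2)] less by linarith
    then have "\<not> H' \<inter> {..q} \<subseteq> H \<inter> {..q}"
      using card_mono[of "H \<inter> {..q}" "H' \<inter> {..q}"] fin(1) by auto
    then obtain x where x: "x \<in> H' - H" "x \<le> q" by auto
    have "\<not> ?tight p" if "p < x" for p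
      using not_less_Least[of p ?tight] that x(2) unfolding q_def by linarith
    then show ?thesis using ext x(1) by blast
  qed
qed

lemma matroid_complex_borel_dominated:
  "matroid_complex n {H. H \<subseteq> {1..n} \<and> borel_dominated F H}"
proof -
  have "borel_dominated F H'" if "borel_dominated F H" "H' \<subseteq> H" "H \<subseteq> {1..n}" for H H'
    unfolding borel_dominated_def
  proof
    fix q
    have "card (H' \<inter> {q<..}) \<le> card (H \<inter> {q<..})"
      using that finite_subset[of H "{1..n}"] by (intro card_mono) auto
    then show "card (H' \<inter> {q<..}) \<le> card (F \<inter> {q<..})"
      using that(1) unfolding borel_dominated_def by (meson le_trans)
  qed
  moreover have "borel_dominated F {}" by (simp add: borel_dominated_def)
  moreover have "\<exists>x\<in>H' - H. insert x H \<subseteq> {1..n} \<and> borel_dominated F (insert x H)"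
    if "H \<subseteq> {1..n}" "H' \<subseteq> {1..n}" "borel_dominated F H" "borel_dominated F H'"
      "card H < card H'" for H H'
    using borel_dominated_augment[of H H' F] that finite_subset[of _ "{1..n}"] by blast
  ultimately show ?thesis
    unfolding matroid_complex_def simplicial_complex_def
    by (intro conjI ballI allI impI) auto
qed

lemma borel_set_dominated:
  assumes "finite F"
  shows "borel_set n {G. G \<subseteq> {1..n} \<and> card G = card F \<and> borel_dominated F G}"
proof -
  have "card (insert i (G - {j})) = card F \<and> borel_dominated F (insert i (G - {j}))"
    if G: "G \<subseteq> {1..n}" "card G = card F" "borel_dominated F G"
      and ij: "i < j" "i \<notin> G" "j \<in> G" for G i j
  proof
    have fin: "finite G" using G(1) finite_subset by blast
    show "card (insert i (G - {j})) = card F"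
      using G(2) ij fin by (metis card_insert_disjoint card_Suc_Diff1 finite_Diff DiffD1)
    show "borel_dominated F (insert i (G - {j}))"
      unfolding borel_dominated_def
    proof
      fix q
      have "card (insert i (G - {j}) \<inter> {q<..}) \<le> card (G \<inter> {q<..})"
      proof (cases "q < i")
        case True
        then have "insert i (G - {j}) \<inter> {q<..} = insert i (G \<inter> {q<..} - {j})" by auto
        moreover have "j \<in> G \<inter> {q<..}" using ij True by simp
        ultimately show ?thesis
          using fin ij(2) by (metis Int_iff DiffD1 card_Suc_Diff1 card_insert_disjoint
              finite_Diff finite_Int order_refl)
      next
        case False
        then show ?thesis using fin by (intro card_mono) auto
      qed
      then show "card (insert i (G - {j}) \<inter> {q<..}) \<le> card (F \<inter> {q<..})"
        using G(3) unfolding borel_dominated_def by (meson le_trans)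
    qed
  qed
  then show ?thesis unfolding borel_set_def by auto
qed

text \<open>
  A Borel move on \<open>F\<close> brings it closer to \<open>G\<close> without destroying dominance: insert
  the largest element \<open>i\<close> of \<open>G - F\<close> and remove some larger \<open>p\<close> in \<open>F - G\<close>. Such a \<open>p\<close> exists since
  \<open>F\<close> has at least as many elements as \<open>G\<close> from \<open>i\<close> on, while \<open>i\<close> itself is missing from \<open>F\<close>.
\<close>

lemma dominated_mem_borel_set:
  assumes \<B>: "borel_set n \<B>" and G: "G \<subseteq> {1..n}"
    and "F \<in> \<B>" "card G = card F" "borel_dominated F G"
  shows "G \<in> \<B>"
  using assms(3-5)
proof (induction "card (F - G)" arbitrary: F rule: less_induct)
  case less
  have finG: "finite G" using G finite_subset by blast
  have finF: "finite F"
    using less.prems(1) \<B> finite_subset[of F "{1..n}"] by (auto simp: borel_set_def)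
  show ?case
  proof (cases "G \<subseteq> F")
    case True
    then show ?thesis using card_subset_eq[OF finF True] less.prems by simp
  next
    case False
    define i where "i = Max (G - F)"
    have i: "i \<in> G - F" unfolding i_def using False finG by (intro Max_in) auto
    have i_max: "x \<le> i" if "x \<in> G - F" for x
      unfolding i_def using that finG by (intro Max_ge) auto
    have "\<exists>p. p \<in> F - G \<and> i < p"
    proof (rule ccontr)
      assume none: "\<nexists>p. p \<in> F - G \<and> i < p"
      have "F \<inter> {i - 1<..} \<subseteq> G \<inter> {i - 1<..} - {i}"
      proof
        fix x assume x: "x \<in> F \<inter> {i - 1<..}"
        then have "x \<noteq> i" using i by blast
        moreover from this x have "i < x" by auto
        ultimately show "x \<in> G \<inter> {i - 1<..} - {i}" using none x by blast
      qed
      moreover have "i \<in> G \<inter> {i - 1<..}" using i G by auto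
      ultimately have "card (F \<inter> {i - 1<..}) < card (G \<inter> {i - 1<..})"
        using finG by (meson card_Diff1_less card_mono finite_Diff finite_Int le_less_trans)
      then show False using less.prems(3) unfolding borel_dominated_def by (meson not_le)
    qed
    then obtain p where p: "p \<in> F - G" "i < p" by blast
    let ?F = "insert i (F - {p})"
    have "?F \<in> \<B>" using \<B> less.prems(1) i p G unfolding borel_set_def by blast
    moreover have "card ?F = card F"
      using finF i p by (metis DiffD1 DiffD2 card_Suc_Diff1 card_insert_disjoint finite_Diff)
    moreover have "borel_dominated ?F G"
      unfolding borel_dominated_def
    proof
      fix q
      show "card (G \<inter> {q<..}) \<le> card (?F \<inter> {q<..})"
      proof (cases "q < i")
        case True
        then have "?F \<inter> {q<..} = insert i (F \<inter> {q<..} - {p})" by auto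
        moreover have "p \<in> F \<inter> {q<..}" using p True by simp
        ultimately have "card (?F \<inter> {q<..}) = card (F \<inter> {q<..})"
          using finF i by (metis Int_iff DiffD1 DiffD2 card_Suc_Diff1 card_insert_disjoint
              finite_Diff finite_Int)
        then show ?thesis using less.prems(3) by (simp add: borel_dominated_def)
      next
        case False
        \<comment> \<open>All elements of \<open>G\<close> above \<open>i\<close> lie in \<open>F\<close>, and removing \<open>p\<close> does not affect them.\<close>
        then have "G \<inter> {q<..} \<subseteq> ?F \<inter> {q<..}" using i_max p by fastforce
        then show ?thesis using finF by (intro card_mono) auto
      qed
    qed
    moreover have "card (?F - G) < card (F - G)"
      using i p finF by (intro psubset_card_mono) auto
    ultimately show ?thesis using less.hyps less.prems(2) by metis
  qed
qed

lemma principal_borel_eq: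
  assumes "F \<subseteq> {1..n}"
  shows "principal_borel n F = {G. G \<subseteq> {1..n} \<and> card G = card F \<and> borel_dominated F G}"
    (is "_ = ?R")
proof
  have "finite F" using assms finite_subset by blast
  then have "borel_set n ?R" by (rule borel_set_dominated)
  moreover have "F \<in> ?R" using assms by (simp add: borel_dominated_def)
  ultimately show "principal_borel n F \<subseteq> ?R" unfolding principal_borel_def by blast
  show "?R \<subseteq> principal_borel n F"
    unfolding principal_borel_def using dominated_mem_borel_set by blast
qed

lemma face_in_facet:
  assumes "simplicial_complex n \<Delta>" "H \<in> \<Delta>"
  shows "\<exists>G\<in>facets \<Delta>. H \<subseteq> G"
proof -
  have "\<Delta> \<subseteq> Pow {1..n}" using assms by (simp add: simplicial_complex_def)
  then have "finite \<Delta>" by (rule finite_subset) simp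
  then obtain G where "G \<in> \<Delta>" "H \<subseteq> G" "\<forall>G'\<in>\<Delta>. G \<subseteq> G' \<longrightarrow> G = G'"
    using finite_has_maximal2[of \<Delta> H] assms(2) by metis
  then show ?thesis by (auto simp: facets_def)
qed

text \<open>
  By augmentation a dominated set extends to a dominated set of the size of \<open>F\<close>, which is a member
  of the principal Borel set and hence a facet.
\<close>

lemma principal_borel_complex_eq:
  assumes F: "F \<subseteq> {1..n}" and \<Delta>: "simplicial_complex n \<Delta>"
    and facets: "facets \<Delta> = principal_borel n F"
  shows "\<Delta> = {H. H \<subseteq> {1..n} \<and> borel_dominated F H}" (is "_ = ?I")
proof
  note M = matroid_complex_borel_dominated[of n F]
  have eq: "facets \<Delta> = {G. G \<in> ?I \<and> card G = card F}"
    using facets principal_borel_eq[OF F] by auto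
  show "\<Delta> \<subseteq> ?I"
  proof
    fix H assume "H \<in> \<Delta>"
    then obtain G where "G \<in> facets \<Delta>" "H \<subseteq> G" using face_in_facet[OF \<Delta>] by blast
    with eq show "H \<in> ?I" using matroid_down[OF M, of G H] by blast
  qed
  show "?I \<subseteq> \<Delta>"
  proof
    fix H assume H: "H \<in> ?I"
    from exists_maximal_extension[OF M H subset_UNIV]
    obtain G where G: "G \<in> ?I" "H \<subseteq> G" and max: "\<forall>H'\<in>?I. card (H' \<inter> UNIV) \<le> card G"
      by (elim bexE conjE) (rule that)
    \<comment> \<open>\<open>F\<close> dominates itself, and threshold \<open>0\<close> bounds the size of every dominated set.\<close>
    have "card F \<le> card G" using max F by (simp add: borel_dominated_def)
    moreover have "card G \<le> card F"
    proof -
      have "G \<inter> {0<..} = G" "F \<inter> {0<..} = F" using G(1) F by auto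
      moreover have "card (G \<inter> {0<..}) \<le> card (F \<inter> {0<..})"
        using G(1) by (simp add: borel_dominated_def)
      ultimately show ?thesis by simp
    qed
    ultimately have "G \<in> facets \<Delta>" using G(1) eq by simp
    then have "G \<in> \<Delta>" by (simp add: facets_def)
    then show "H \<in> \<Delta>" using \<Delta> G(2) unfolding simplicial_complex_def by blast
  qed
qed

section \<open>The cover algebra in terms of exponents\<close>

text \<open>
  The exponents of the monomials in \<open>J\<^sub>k\<close>. With the zero vector included for \<open>k = 0\<close>, the family is
  closed under addition of vectors and degrees, which is multiplicativity of the filtration
  \<open>J\<^sub>k\<close>.
\<close>

definition cover_exponents :: "nat \<Rightarrow> nat set set \<Rightarrow> nat \<Rightarrow> (nat \<Rightarrow>\<^sub>0 nat) set" where
  "cover_exponents n \<Gamma> k =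
     (if k = 0 then {c. Poly_Mapping.keys c \<subseteq> {1..n}} else {c. k_cover n \<Gamma> k c})"

lemma scale_xpow: "scale a (xpow c) = Poly_Mapping.single c a"
  by (simp add: scale_def xpow_def mult_single)

lemma sum_single_keys:
  fixes p :: "'a \<Rightarrow>\<^sub>0 'b::comm_monoid_add"
  shows "(\<Sum>c\<in>Poly_Mapping.keys p. Poly_Mapping.single c (Poly_Mapping.lookup p c)) = p"
proof (rule poly_mapping_eqI)
  fix c
  show "Poly_Mapping.lookup (\<Sum>c\<in>Poly_Mapping.keys p. Poly_Mapping.single c (Poly_Mapping.lookup p c)) c
      = Poly_Mapping.lookup p c"
    by (simp add: lookup_sum lookup_single when_def sum.delta in_keys_iff)
qed

lemma keys_scale: "Poly_Mapping.keys (scale a p) \<subseteq> Poly_Mapping.keys p"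
  using keys_mult[of "Poly_Mapping.single 0 a" p] by (auto simp: scale_def split: if_splits)

text \<open>
  A span of monomials is a support condition, which turns membership in the ideals \<open>J\<^sub>k\<close> into a
  condition on exponents.
\<close>

lemma span_xpow:
  "mpoly.span {xpow c | c. c \<in> E} = {p :: 'k::field mpoly. Poly_Mapping.keys p \<subseteq> E}"
proof
  have "mpoly.subspace {p :: 'k mpoly. Poly_Mapping.keys p \<subseteq> E}"
  proof (rule mpoly.subspaceI)
    fix p q :: "'k mpoly" and a :: 'k
    assume p: "p \<in> {p. Poly_Mapping.keys p \<subseteq> E}"
    then show "scale a p \<in> {p. Poly_Mapping.keys p \<subseteq> E}" using keys_scale[of a p] by auto
    assume "q \<in> {p. Poly_Mapping.keys p \<subseteq> E}"
    with p show "p + q \<in> {p. Poly_Mapping.keys p \<subseteq> E}"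
      using Poly_Mapping.keys_add[of p q] by auto
  qed simp
  then show "mpoly.span {xpow c | c. c \<in> E} \<subseteq> {p :: 'k mpoly. Poly_Mapping.keys p \<subseteq> E}"
    by (intro mpoly.span_minimal) (auto simp: xpow_def)
  show "{p :: 'k mpoly. Poly_Mapping.keys p \<subseteq> E} \<subseteq> mpoly.span {xpow c | c. c \<in> E}"
  proof
    fix p :: "'k mpoly" assume "p \<in> {p. Poly_Mapping.keys p \<subseteq> E}"
    then have "(\<Sum>c\<in>Poly_Mapping.keys p. scale (Poly_Mapping.lookup p c) (xpow c))
        \<in> mpoly.span {xpow c | c. c \<in> E}"
      by (intro mpoly.span_sum mpoly.span_scale mpoly.span_base) auto
    then show "p \<in> mpoly.span {xpow c | c. c \<in> E}" by (simp add: scale_xpow sum_single_keys)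
  qed
qed

lemma cover_ideal_eq:
  "cover_ideal n \<Gamma> k = {p. Poly_Mapping.keys p \<subseteq> cover_exponents n \<Gamma> k}"
  using span_xpow[of "{c. k_cover n \<Gamma> k c}"]
  by (auto simp: cover_ideal_def cover_exponents_def poly_ring_def)

lemma cover_exponents_iff:
  "c \<in> cover_exponents n \<Gamma> k \<longleftrightarrow> Poly_Mapping.keys c \<subseteq> {1..n} \<and> (k > 0 \<longrightarrow> c \<noteq> 0) \<and>
     (\<forall>G\<in>facets \<Gamma>. k \<le> (\<Sum>i\<in>G. Poly_Mapping.lookup c i))"
  by (auto simp: cover_exponents_def k_cover_def)

lemma cover_exponents_add:
  assumes "c \<in> cover_exponents n \<Gamma> k" "c' \<in> cover_exponents n \<Gamma> k'"
  shows "c + c' \<in> cover_exponents n \<Gamma> (k + k')"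
proof -
  have "Poly_Mapping.keys (c + c') \<subseteq> {1..n}"
    using assms Poly_Mapping.keys_add[of c c'] by (auto simp: cover_exponents_iff)
  moreover have "c = 0 \<and> c' = 0" if "c + c' = 0"
  proof -
    have "Poly_Mapping.lookup c i + Poly_Mapping.lookup c' i = 0" for i
      using that by (metis lookup_add lookup_zero)
    then show ?thesis by (auto intro!: poly_mapping_eqI)
  qed
  ultimately show ?thesis
    using assms by (auto simp: cover_exponents_iff lookup_add sum.distrib add_mono)
qed

lemma cover_ideal_mult:
  assumes "p \<in> cover_ideal n \<Gamma> k" "q \<in> cover_ideal n \<Gamma> k'"
  shows "p * q \<in> cover_ideal n \<Gamma> (k + k')"
  using assms keys_mult[of p q] cover_exponents_add by (fastforce simp: cover_ideal_eq)

lemma cover_ideal_zero: "0 \<in> cover_ideal n \<Gamma> k"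
  by (simp add: cover_ideal_eq)

lemma cover_ideal_add:
  assumes "p \<in> cover_ideal n \<Gamma> k" "q \<in> cover_ideal n \<Gamma> k"
  shows "p + q \<in> cover_ideal n \<Gamma> k"
  using assms Poly_Mapping.keys_add[of p q] by (auto simp: cover_ideal_eq)

lemma cover_ideal_sum:
  assumes "\<And>i. i \<in> I \<Longrightarrow> f i \<in> cover_ideal n \<Gamma> k"
  shows "sum f I \<in> cover_ideal n \<Gamma> k"
  using assms by (induction I rule: infinite_finite_induct) (auto intro: cover_ideal_zero cover_ideal_add)

lemma squarefree_cover_algebra_subset:
  "squarefree_cover_algebra n \<Gamma> \<subseteq> cover_algebra n \<Gamma>"
proof
  fix p :: "'a mpoly poly" assume "p \<in> squarefree_cover_algebra n \<Gamma>"
  then show "p \<in> cover_algebra n \<Gamma>"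
  proof (induction rule: squarefree_cover_algebra.induct)
    case (const s)
    then show ?case
      by (auto simp: cover_algebra_def coeff_pCons cover_ideal_zero split: nat.split)
        (simp add: cover_ideal_def)
  next
    case (gen k c)
    then have "xpow c \<in> cover_ideal n \<Gamma> k"
      by (auto simp: cover_ideal_eq cover_exponents_def xpow_def squarefree_cover_def)
    then show ?case by (simp add: cover_algebra_def cover_ideal_zero)
  next
    case (add p q)
    then show ?case by (simp add: cover_algebra_def cover_ideal_add)
  next
    case (mult p q)
    have "coeff p i * coeff q (k - i) \<in> cover_ideal n \<Gamma> k" if "i \<le> k" for i k
      using cover_ideal_mult[of "coeff p i" n \<Gamma> i "coeff q (k - i)" "k - i"] mult.IH that
      by (simp add: cover_algebra_def)
    then show ?case by (auto simp: cover_algebra_def coeff_mult intro!: cover_ideal_sum)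
  qed
qed

lemma squarefree_cover_algebra_sum:
  assumes "\<And>i. i \<in> I \<Longrightarrow> f i \<in> squarefree_cover_algebra n \<Gamma>"
  shows "sum f I \<in> squarefree_cover_algebra n \<Gamma>"
proof -
  have "[:0:] \<in> squarefree_cover_algebra n \<Gamma>"
    by (rule squarefree_cover_algebra.const) (simp add: poly_ring_def)
  then show ?thesis using assms
    by (induction I rule: infinite_finite_induct) (auto intro: squarefree_cover_algebra.add)
qed

section \<open>Decomposing covers into squarefree covers\<close>

text \<open>
  The degree \<open>k\<close> need not exhaust the sum of the \<open>r t\<close>: an \<open>r\<close>-cover is also an \<open>l\<close>-cover for every
  \<open>l \<le> r\<close>, so each factor takes as much of \<open>k\<close> as it can. Factors that take nothing are monomials
  of \<open>S\<close>.
\<close>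

lemma squarefree_product_mem:
  assumes fin: "finite T"
    and c: "\<And>t i. t \<in> T \<Longrightarrow> Poly_Mapping.lookup (c t) i \<le> 1"
      "\<And>t. t \<in> T \<Longrightarrow> c t \<in> cover_exponents n \<Gamma> (r t)"
    and k: "k \<le> (\<Sum>t\<in>T. r t)"
  shows "(monom (xpow (\<Sum>t\<in>T. c t)) k :: 'k::field mpoly poly) \<in> squarefree_cover_algebra n \<Gamma>"
  using assms
proof (induction T arbitrary: k rule: finite_induct)
  case empty
  then show ?case
    by (auto simp: monom_0 xpow_def poly_ring_def intro: squarefree_cover_algebra.const)
next
  case (insert t T)
  define l where "l = min k (r t)"
  have "(monom (xpow (c t)) l :: 'k mpoly poly) \<in> squarefree_cover_algebra n \<Gamma>"
  proof (cases "l = 0")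
    case True
    then show ?thesis using insert.prems(2)[of t]
      by (auto simp: monom_0 xpow_def poly_ring_def cover_exponents_iff
          intro!: squarefree_cover_algebra.const)
  next
    case False
    then have "squarefree_cover n \<Gamma> l (c t)"
      using insert.prems(1,2)[of t]
      by (fastforce simp: l_def squarefree_cover_def k_cover_def cover_exponents_iff)
    then show ?thesis using False by (intro squarefree_cover_algebra.gen) auto
  qed
  moreover have "(monom (xpow (\<Sum>t\<in>T. c t)) (k - l) :: 'k mpoly poly)
      \<in> squarefree_cover_algebra n \<Gamma>"
    using insert by (intro insert.IH) (auto simp: l_def)
  ultimately have "(monom (xpow (c t)) l * monom (xpow (\<Sum>t\<in>T. c t)) (k - l) :: 'k mpoly poly)
      \<in> squarefree_cover_algebra n \<Gamma>"
    by (rule squarefree_cover_algebra.mult)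
  then show ?case using insert.hyps
    by (simp add: mult_monom xpow_def mult_single l_def)
qed

definition level_indicator :: "nat \<Rightarrow> (nat \<Rightarrow>\<^sub>0 nat) \<Rightarrow> (nat \<Rightarrow>\<^sub>0 nat)" where
  "level_indicator t c = Poly_Mapping.map (\<lambda>v. if t \<le> v then 1 else 0) c"

lemma lookup_level_indicator:
  "t > 0 \<Longrightarrow> Poly_Mapping.lookup (level_indicator t c) i = (if t \<le> Poly_Mapping.lookup c i then 1 else 0)"
  by (auto simp: level_indicator_def map.rep_eq when_def)

lemma sum_level_indicator:
  assumes "\<And>i. Poly_Mapping.lookup c i \<le> m"
  shows "(\<Sum>t=1..m. level_indicator t c) = c"
proof (rule poly_mapping_eqI)
  fix i
  have "Poly_Mapping.lookup (\<Sum>t=1..m. level_indicator t c) i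
      = (\<Sum>t=1..m. if t \<le> Poly_Mapping.lookup c i then 1 else 0)"
    by (simp add: lookup_sum lookup_level_indicator)
  also have "\<dots> = card ({1..m} \<inter> {t. t \<le> Poly_Mapping.lookup c i})"
    by (simp add: sum.If_cases)
  also have "{1..m} \<inter> {t. t \<le> Poly_Mapping.lookup c i} = {1..Poly_Mapping.lookup c i}"
    using assms[of i] by auto
  finally show "Poly_Mapping.lookup (\<Sum>t=1..m. level_indicator t c) i = Poly_Mapping.lookup c i"
    by simp
qed

text \<open>
  The facet minimizing all level sets at once is what makes the degrees add up: with the minima
  \<open>r t\<close> attained on a common facet \<open>G\<close>, their sum is the \<open>c\<close>-weight of \<open>G\<close> and so is at least \<open>k\<close>.
  Minima attained on different facets would only sum to at most the least weight of a facet.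
\<close>

lemma monom_cover_mem:
  assumes M: "matroid_complex n \<Gamma>" and c: "c \<in> cover_exponents n \<Gamma> k"
  shows "(monom (xpow c) k :: 'k::field mpoly poly) \<in> squarefree_cover_algebra n \<Gamma>"
proof -
  define m where "m = (\<Sum>i\<in>Poly_Mapping.keys c. Poly_Mapping.lookup c i)"
  have bound: "Poly_Mapping.lookup c i \<le> m" for i
    unfolding m_def by (cases "i \<in> Poly_Mapping.keys c") (auto intro: member_le_sum simp: in_keys_iff)
  obtain G where G: "G \<in> facets \<Gamma>" and min: "\<And>t G'. t \<le> m \<Longrightarrow> G' \<in> facets \<Gamma> \<Longrightarrow>
      card (G \<inter> {i. t \<le> Poly_Mapping.lookup c i}) \<le> card (G' \<inter> {i. t \<le> Poly_Mapping.lookup c i})"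
    using exists_facet_minimizing_all_levels[OF M, of "Poly_Mapping.lookup c", OF bound] by blast
  define r where "r t = card (G \<inter> {i. t \<le> Poly_Mapping.lookup c i})" for t
  have finite_facet: "finite G'" if "G' \<in> facets \<Gamma>" for G'
    using matroid_finite[OF M] that by (auto simp: facets_def)
  have weight: "(\<Sum>i\<in>G'. Poly_Mapping.lookup (level_indicator t c) i)
      = card (G' \<inter> {i. t \<le> Poly_Mapping.lookup c i})" if "G' \<in> facets \<Gamma>" "t > 0" for G' t
    using that finite_facet by (simp add: lookup_level_indicator sum.If_cases)
  have "level_indicator t c \<in> cover_exponents n \<Gamma> (r t)" if t: "t \<in> {1..m}" for t
  proof -
    have "Poly_Mapping.keys (level_indicator t c) \<subseteq> Poly_Mapping.keys c"
      using t by (auto simp: in_keys_iff lookup_level_indicator split: if_splits)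
    moreover have "level_indicator t c \<noteq> 0" if "r t > 0"
      using that weight[OF G, of t] t by (auto simp: r_def)
    ultimately show ?thesis
      using c t weight min by (auto simp: cover_exponents_iff r_def)
  qed
  moreover have "k \<le> (\<Sum>t=1..m. r t)"
  proof -
    have "k \<le> (\<Sum>i\<in>G. Poly_Mapping.lookup c i)"
      using c G by (auto simp: cover_exponents_iff)
    also have "\<dots> = (\<Sum>i\<in>G. Poly_Mapping.lookup (\<Sum>t=1..m. level_indicator t c) i)"
      using sum_level_indicator[of c m] bound by simp
    also have "\<dots> = (\<Sum>t=1..m. \<Sum>i\<in>G. Poly_Mapping.lookup (level_indicator t c) i)"
      unfolding lookup_sum by (rule sum.swap)
    also have "\<dots> = (\<Sum>t=1..m. r t)"
      using weight[OF G] by (intro sum.cong) (auto simp: r_def)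
    finally show ?thesis .
  qed
  ultimately have "(monom (xpow (\<Sum>t=1..m. level_indicator t c)) k :: 'k mpoly poly)
      \<in> squarefree_cover_algebra n \<Gamma>"
    by (intro squarefree_product_mem[where r = r]) (auto simp: lookup_level_indicator)
  then show ?thesis using sum_level_indicator[of c m] bound by simp
qed

text \<open>
  The cover algebra is spanned by its monomials \<open>x\<^sup>c t\<^sup>k\<close>, so the decomposition of a single monomial
  suffices.
\<close>

lemma matroid_cover_algebra_eq:
  assumes M: "matroid_complex n \<Gamma>"
  shows "(squarefree_cover_algebra n \<Gamma> :: 'k::field mpoly poly set) = cover_algebra n \<Gamma>"
proof (rule equalityI[OF squarefree_cover_algebra_subset], rule subsetI)
  fix p :: "'k mpoly poly" assume p: "p \<in> cover_algebra n \<Gamma>"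
  have "monom (coeff p k) k \<in> squarefree_cover_algebra n \<Gamma>" for k
  proof -
    let ?q = "coeff p k"
    have "[:Poly_Mapping.single 0 (Poly_Mapping.lookup ?q c):] * monom (xpow c) k
        \<in> squarefree_cover_algebra n \<Gamma>" if "c \<in> Poly_Mapping.keys ?q" for c
    proof (intro squarefree_cover_algebra.mult squarefree_cover_algebra.const monom_cover_mem[OF M])
      show "c \<in> cover_exponents n \<Gamma> k"
        using p that by (auto simp: cover_algebra_def cover_ideal_eq)
    qed (simp add: poly_ring_def)
    then have "(\<Sum>c\<in>Poly_Mapping.keys ?q. monom (Poly_Mapping.single c (Poly_Mapping.lookup ?q c)) k)
        \<in> squarefree_cover_algebra n \<Gamma>"
      by (intro squarefree_cover_algebra_sum) (simp add: smult_monom xpow_def mult_single)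
    then show ?thesis by (simp add: sum_single_keys flip: monom_sum)
  qed
  then have "(\<Sum>k\<le>degree p. monom (coeff p k) k) \<in> squarefree_cover_algebra n \<Gamma>"
    by (intro squarefree_cover_algebra_sum)
  then show "p \<in> squarefree_cover_algebra n \<Gamma>" by (simp add: poly_as_sum_of_monoms)
qed

theorem corollary3p6:
  fixes n d j :: nat and F :: "nat set" and \<B> \<Delta> :: "nat set set"
  assumes "F \<subseteq> {1..n}" and "card F = d"
    and "\<B> = principal_borel n F"
    and "simplicial_complex n \<Delta>" and "facets \<Delta> = \<B>"
    and "j < d"
  shows "(squarefree_cover_algebra n (skeleton \<Delta> j) :: 'k::field mpoly poly set)
           = cover_algebra n (skeleton \<Delta> j)"
proof -
  have "matroid_complex n \<Delta>"
    using principal_borel_complex_eq[of F n \<Delta>] assms matroid_complex_borel_dominated[of n F] by simp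
  then show ?thesis by (intro matroid_cover_algebra_eq matroid_complex_skeleton)
qed

end
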